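(* Let $(\mathbf{x}^1,y^1),\ldots,(\mathbf{x}^T,y^T)$ be a sequence of examples with $\mathbf{x}^t\in\mathcal{X}\subseteq\mathbb{R}^d$, $y^t\in[K]$, presented to the algorithm DFORD-Linear, and let $\mathbf{u}^1,\ldots,\mathbf{u}^{T+1}$, $\mathbf{u}^t=(\mathbf{w}^t,\boldsymbol{\theta}^t)$, be the (random) sequence of parameter vectors it generates. Suppose $\|\mathbf{x}^t\|\le R$ for all $t\in[T]$. Then for every $\mathbf{u}=(\mathbf{w},\boldsymbol{\theta})\in\mathbb{R}^d\times\mathbb{R}^{K-1}$, $$\mathbb{E}_{P^{[T]}}\left[\sum_{t=1}^T L^{H}_{reg}(\mathbf{u}^t,\mathbf{x}^t,y^t)-\sum_{t=1}^T L^{H}_{reg}(\mathbf{u},\mathbf{x}^t,y^t)\right]\le \frac{16K^2(R^2+1)\,\ln K\,\ln T}{\lambda\gamma}.$$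
   Context: $[K]=\{1,\ldots,K\}$ is the ordered label set, $K,T$ are positive integers, $\lambda>0$ and $\gamma\in(0,1]$ are parameters, and the sequence of examples is fixed (non-random). Parameter vectors are $\mathbf{u}=(\mathbf{w},\boldsymbol{\theta})$ with $\mathbf{w}\in\mathbb{R}^d$, $\boldsymbol{\theta}=(\theta_1,\ldots,\theta_{K-1})\in\mathbb{R}^{K-1}$, and by convention $\theta_K=+\infty$ always (it is never updated; $0\cdot\infty=0$). Loss. For $(\mathbf{x},y)$ let $z_i=+1$ if $i<y$ and $z_i=-1$ if $i\ge y$, $i\in[K]$. Then $$L^H_{reg}(\mathbf{u},\mathbf{x},y)=\frac{\lambda}{2}\left(\|\mathbf{w}\|^2+\|\boldsymbol{\theta}\|^2\right)+\sum_{i=1}^{K}\max\bigl(0,-z_i(\mathbf{w}\cdot\mathbf{x}-\theta_i)\bigr),$$ where the $i=K$ term is $0$ because $\theta_K=+\infty$ and $z_K=-1$. Algorithm DFORD-Linear. Start with $\mathbf{w}^1=\mathbf{0}$, $\boldsymbol{\theta}^1=\mathbf{0}$. In round $t=1,\ldots,T$: 1. $\hat y^t=\min\{i\in[K]:\mathbf{w}^t\cdot\mathbf{x}^t-\theta^t_i\le 0\}$. 2. Let $P^t=(1-\gamma)P_1^t+\gamma P_2^t$ on $[K]$, where $P_1^t(i)=\mathbb{I}[i=\hat y^t]$ and $P_2^t(i)=\dfrac{1+d_{\max}^t-|i-\hat y^t|}{Z^t}$ with $d_{\max}^t=\max\{\hat y^t,K-\hat y^t\}$ and $Z^t=\sum_{i=1}^K(1+d_{\max}^t-|i-\hat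 y^t|)$. 3. Sample $\tilde y^t\sim P^t$ (conditionally on the past) and observe $d_t=\mathbb{I}[\tilde y^t<y^t]$. 4. Set $\tilde z_i^t=\dfrac{(2d_t-1)\mathbb{I}[i=\tilde y^t]}{P^t(i)}$ and $\tilde\tau_i^t=\tilde z_i^t\,\mathbb{I}[\tilde z_i^t(\mathbf{w}^t\cdot\mathbf{x}^t-\theta_i^t)\le 0]$, $i\in[K]$ (so $\tilde\tau^t_i=0$ for $i\neq\tilde y^t$, and $\tilde\tau_K^t=0$). 5. With $\eta_t=\frac{1}{\lambda t}$, update $\mathbf{w}^{t+1}=(1-\eta_t\lambda)\mathbf{w}^t+\eta_t\tilde\tau^t_{\tilde y^t}\mathbf{x}^t$ and $\theta_i^{t+1}=(1-\eta_t\lambda)\theta_i^t-\mathbb{I}[i=\tilde y^t]\eta_t\tilde\tau^t_{\tilde y^t}$ for $i\in[K-1]$. $\mathbb{E}_{P^{[T]}}$ denotes expectation over the joint distribution of $\tilde y^1,\ldots,\tilde y^T$. *)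

theory Defs
  imports "HOL-Probability.Probability"
begin

text \<open>
  A parameter vector is a pair \<open>(w, \<theta>)\<close> with \<open>w\<close> in \<open>real ^ 'd\<close>. The threshold vector is a function
  on indices of which only the entries \<open>1, \<dots>, K - 1\<close> are ever read; a type-indexed vector would
  exclude \<open>K = 1\<close>. The convention that the \<open>K\<close>-th threshold is infinite is built into the
  \<open>ereal\<close>-valued \<open>threshold\<close>, and \<open>ereal\<close> multiplication satisfies \<open>0 * \<infinity> = 0\<close>.
\<close>

type_synonym 'd param = "(real ^ 'd) \<times> (nat \<Rightarrow> real)"

definition threshold :: "nat \<Rightarrow> (nat \<Rightarrow> real) \<Rightarrow> nat \<Rightarrow> ereal" where
  "threshold K \<theta> i = (if i < K then ereal (\<theta> i) else \<infinity>)"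

definition margin :: "nat \<Rightarrow> 'd::finite param \<Rightarrow> real ^ 'd \<Rightarrow> nat \<Rightarrow> ereal" where
  "margin K u xt i = ereal (fst u \<bullet> xt) - threshold K (snd u) i"

definition label_sign :: "nat \<Rightarrow> nat \<Rightarrow> real" where
  "label_sign yt i = (if i < yt then 1 else - 1)"

text \<open>
  Every summand is finite: for \<open>i = K\<close> and \<open>yt \<le> K\<close> the second argument of \<open>max\<close> is \<open>-\<infinity>\<close>.
\<close>

definition reg_loss :: "nat \<Rightarrow> real \<Rightarrow> 'd::finite param \<Rightarrow> real ^ 'd \<Rightarrow> nat \<Rightarrow> real" where
  "reg_loss K lam u xt yt =
     lam / 2 * ((norm (fst u))\<^sup>2 + (\<Sum>i\<in>{1..<K}. (snd u i)\<^sup>2)) +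
     (\<Sum>i\<in>{1..K}. real_of_ereal (max 0 (- ereal (label_sign yt i) * margin K u xt i)))"

definition predicted_label :: "nat \<Rightarrow> 'd::finite param \<Rightarrow> real ^ 'd \<Rightarrow> nat" where
  "predicted_label K u xt = Min {i \<in> {1..K}. margin K u xt i \<le> 0}"

definition d_max :: "nat \<Rightarrow> nat \<Rightarrow> nat" where
  "d_max K yhat = max yhat (K - yhat)"

definition explore_weight :: "nat \<Rightarrow> nat \<Rightarrow> nat \<Rightarrow> real" where
  "explore_weight K yhat i = 1 + real (d_max K yhat) - \<bar>real i - real yhat\<bar>"

definition explore_prob :: "nat \<Rightarrow> nat \<Rightarrow> nat \<Rightarrow> real" where
  "explore_prob K yhat i = explore_weight K yhat i / (\<Sum>j\<in>{1..K}. explore_weight K yhat j)"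

definition sample_prob :: "nat \<Rightarrow> real \<Rightarrow> nat \<Rightarrow> nat \<Rightarrow> real" where
  "sample_prob K \<gamma> yhat i = (1 - \<gamma>) * of_bool (i = yhat) + \<gamma> * explore_prob K yhat i"

definition sample_pmf :: "nat \<Rightarrow> real \<Rightarrow> nat \<Rightarrow> nat pmf" where
  "sample_pmf K \<gamma> yhat = embed_pmf (\<lambda>i. if i \<in> {1..K} then sample_prob K \<gamma> yhat i else 0)"

definition z_tilde ::
  "nat \<Rightarrow> real \<Rightarrow> 'd::finite param \<Rightarrow> real ^ 'd \<Rightarrow> nat \<Rightarrow> nat \<Rightarrow> nat \<Rightarrow> real" where
  "z_tilde K \<gamma> u xt yt ytil i =
     (2 * of_bool (ytil < yt) - 1) * of_bool (i = ytil) /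
       sample_prob K \<gamma> (predicted_label K u xt) i"

definition tau_tilde ::
  "nat \<Rightarrow> real \<Rightarrow> 'd::finite param \<Rightarrow> real ^ 'd \<Rightarrow> nat \<Rightarrow> nat \<Rightarrow> nat \<Rightarrow> real" where
  "tau_tilde K \<gamma> u xt yt ytil i =
     z_tilde K \<gamma> u xt yt ytil i *
       of_bool (ereal (z_tilde K \<gamma> u xt yt ytil i) * margin K u xt i \<le> 0)"

definition dford_step ::
  "nat \<Rightarrow> real \<Rightarrow> real \<Rightarrow> nat \<Rightarrow> real ^ 'd \<Rightarrow> nat \<Rightarrow> nat \<Rightarrow> 'd::finite param \<Rightarrow> 'd param" where
  "dford_step K lam \<gamma> t xt yt ytil u =
     (let \<eta> = 1 / (lam * real t); \<tau> = tau_tilde K \<gamma> u xt yt ytil ytil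
      in ((1 - \<eta> * lam) *\<^sub>R fst u + (\<eta> * \<tau>) *\<^sub>R xt,
          \<lambda>i. if i \<in> {1..<K} then (1 - \<eta> * lam) * snd u i - of_bool (i = ytil) * \<eta> * \<tau> else 0))"

text \<open>
  \<open>dford_iterate K lam \<gamma> x y ytil t\<close> is the parameter vector at the start of round \<open>t \<ge> 1\<close> when the
  sampled labels are \<open>ytil 1, ytil 2, \<dots>\<close>; it depends only on \<open>ytil 1, \<dots>, ytil (t - 1)\<close>.
  Rounds are counted from 1 and the value at \<open>t = 0\<close> is a dummy.
\<close>

fun dford_iterate ::
  "nat \<Rightarrow> real \<Rightarrow> real \<Rightarrow> (nat \<Rightarrow> real ^ 'd) \<Rightarrow> (nat \<Rightarrow> nat) \<Rightarrow> (nat \<Rightarrow> nat) \<Rightarrow> nat \<Rightarrow>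
    'd::finite param" where
  "dford_iterate K lam \<gamma> x y ytil 0 = (0, \<lambda>_. 0)"
| "dford_iterate K lam \<gamma> x y ytil (Suc 0) = (0, \<lambda>_. 0)"
| "dford_iterate K lam \<gamma> x y ytil (Suc (Suc t)) =
     dford_step K lam \<gamma> (Suc t) (x (Suc t)) (y (Suc t)) (ytil (Suc t))
       (dford_iterate K lam \<gamma> x y ytil (Suc t))"

text \<open>
  Joint distribution of the labels sampled in rounds \<open>1, \<dots>, T\<close>, as a distribution on functions
  that are \<open>0\<close> outside \<open>{1..T}\<close>.
\<close>

primrec dford_pmf ::
  "nat \<Rightarrow> real \<Rightarrow> real \<Rightarrow> (nat \<Rightarrow> real ^ 'd::finite) \<Rightarrow> (nat \<Rightarrow> nat) \<Rightarrow> nat \<Rightarrow> (nat \<Rightarrow> nat) pmf" where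
  "dford_pmf K lam \<gamma> x y 0 = return_pmf (\<lambda>_. 0)"
| "dford_pmf K lam \<gamma> x y (Suc t) =
     bind_pmf (dford_pmf K lam \<gamma> x y t) (\<lambda>ytil.
       map_pmf (\<lambda>k. ytil(Suc t := k))
         (sample_pmf K \<gamma>
           (predicted_label K (dford_iterate K lam \<gamma> x y ytil (Suc t)) (x (Suc t)))))"

text \<open>
  The side conditions of \<open>embed_pmf\<close> hold, so \<open>sample_pmf\<close> is the intended distribution, and the
  joint distribution is finitely supported, so every random variable has an expectation under it.
\<close>

lemma predicted_label_in:
  assumes "K \<ge> 1"
  shows "predicted_label K u xt \<in> {1..K}"
proof -
  have "K \<in> {i \<in> {1..K}. margin K u xt i \<le> 0}"
    using assms by (simp add: margin_def threshold_def)
  then have "Min {i \<in> {1..K}. margin K u xt i \<le> 0} \<in> {i \<in> {1..K}. margin K u xt i \<le> 0}"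
    by (intro Min_in) auto
  then show ?thesis by (simp add: predicted_label_def)
qed

lemma explore_weight_pos:
  assumes "yhat \<in> {1..K}" "i \<in> {1..K}"
  shows "explore_weight K yhat i > 0"
  using assms by (auto simp: explore_weight_def d_max_def max_def abs_if)

lemma pmf_sample_pmf:
  assumes "yhat \<in> {1..K}" "0 < \<gamma>" "\<gamma> \<le> 1"
  shows "pmf (sample_pmf K \<gamma> yhat) i = (if i \<in> {1..K} then sample_prob K \<gamma> yhat i else 0)"
proof -
  let ?f = "\<lambda>i. if i \<in> {1..K} then sample_prob K \<gamma> yhat i else 0"
  let ?Z = "\<Sum>j\<in>{1..K}. explore_weight K yhat j"
  have Z: "?Z > 0"
    using assms explore_weight_pos by (intro sum_pos) auto
  have nn: "0 \<le> ?f j" for j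
    using assms explore_weight_pos[of yhat K j] Z
    by (auto simp: sample_prob_def explore_prob_def intro!: add_nonneg_nonneg mult_nonneg_nonneg
        divide_nonneg_pos)
  have "(\<Sum>i\<in>{1..K}. explore_prob K yhat i) = 1"
    using Z by (simp add: explore_prob_def sum_divide_distrib[symmetric])
  moreover have "(\<Sum>i\<in>{1..K}. of_bool (i = yhat)) = (1::real)"
    using assms by (simp add: of_bool_def)
  ultimately have "(\<Sum>i\<in>{1..K}. sample_prob K \<gamma> yhat i) = 1"
    by (simp add: sample_prob_def sum.distrib sum_distrib_left[symmetric])
  moreover have "(\<integral>\<^sup>+ i. ennreal (?f i) \<partial>count_space UNIV) = (\<Sum>i\<in>{1..K}. ennreal (?f i))"
    by (intro nn_integral_count_space') auto
  moreover have "\<dots> = ennreal (\<Sum>i\<in>{1..K}. ?f i)"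
    by (rule sum_ennreal) (rule nn)
  ultimately have "(\<integral>\<^sup>+ i. ennreal (?f i) \<partial>count_space UNIV) = 1"
    by simp
  then show ?thesis
    unfolding sample_pmf_def using nn by (subst pmf_embed_pmf) auto
qed

lemma finite_set_dford_pmf:
  assumes "K \<ge> 1" "0 < \<gamma>" "\<gamma> \<le> 1"
  shows "finite (set_pmf (dford_pmf K lam \<gamma> x y t))"
proof (induction t)
  case (Suc t)
  have "finite (set_pmf (sample_pmf K \<gamma> (predicted_label K u xt)))" for u and xt :: "real ^ 'a"
    by (rule finite_subset[of _ "{1..K}"])
      (auto simp: set_pmf_eq pmf_sample_pmf[OF predicted_label_in[OF assms(1)] assms(2,3)]
        split: if_splits)
  with Suc show ?case by simp
qed simp

end

theory Submission imports Defs begin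

text \<open>
  The update is stochastic gradient descent on a \<open>lam\<close>-strongly convex objective: given the past,
  \<open>tau_tilde\<close> is an unbiased estimate of the hinge subgradient. With step size \<open>1 / (lam * t)\<close> the
  weighted squared distances \<open>lam * t / 2 * \<parallel>u - c\<parallel>\<^sup>2\<close> to the comparator \<open>c\<close> telescope, leaving the
  sum of \<open>E \<parallel>g\<^sub>t\<parallel>\<^sup>2 / (2 * lam * t)\<close>. The second moment of the hinge part is at most
  \<open>(R\<^sup>2 + 1) * (\<Sum>i<K. 1 / P i)\<close>, and \<open>lam\<close> times the current iterate is an average of earlier
  hinge parts, so it obeys the same bound. Finally, the exploration weight of \<open>i\<close> is at least
  \<open>min (1 + i) (1 + K - i)\<close>, so the sum of inverse probabilities is of order \<open>K\<^sup>2 * ln K / \<gamma>\<close>.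
\<close>

section \<open>Harmonic numbers and expectations over finite supports\<close>

text \<open>The increment \<open>ln (n + 1) - ln n\<close> is at least \<open>1 / (n + 1)\<close>,
  by \<open>ln z \<le> z - 1\<close> at \<open>z = n / (n + 1)\<close>.\<close>

lemma harm_le_ln:
  assumes "n \<ge> 1"
  shows "harm n \<le> 1 + ln (real n)"
  using assms
proof (induction n rule: nat_induct_at_least)
  case (Suc n)
  have "ln (real n / real (Suc n)) \<le> real n / real (Suc n) - 1"
    using Suc by (intro ln_le_minus_one) auto
  also have "\<dots> = - inverse (real (Suc n))"
    by (simp add: field_simps)
  finally show ?case
    using Suc by (simp add: harm_Suc ln_div)
qed (simp add: harm_expand)

lemma expectation_bind_pmf_finite:
  fixes h :: "'b \<Rightarrow> real"
  assumes "finite (set_pmf p)" "\<And>a. finite (set_pmf (f a))"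
  shows "measure_pmf.expectation (bind_pmf p f) h =
         measure_pmf.expectation p (\<lambda>a. measure_pmf.expectation (f a) h)"
  using assms
  by (simp add: pmf_expectation_bind[OF assms(1) assms(2) order_refl]
      integral_measure_pmf[OF assms(1)])

section \<open>The exploration distribution and its inverse probabilities\<close>

text \<open>For \<open>i \<le> yhat\<close> the part \<open>yhat\<close> of \<open>d_max\<close>
  yields \<open>1 + i\<close>; for \<open>i \<ge> yhat\<close> the part \<open>K - yhat\<close>
  yields \<open>1 + K - i\<close>. The resulting bound does not depend on the prediction.\<close>

lemma explore_weight_ge:
  assumes "yhat \<in> {1..K}" "i \<in> {1..<K}"
  shows "min (1 + real i) (1 + real (K - i)) \<le> explore_weight K yhat i"
  using assms by (auto simp: explore_weight_def d_max_def max_def abs_if)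

lemma sum_explore_weight_le:
  assumes "yhat \<in> {1..K}"
  shows "(\<Sum>j\<in>{1..K}. explore_weight K yhat j) \<le> real K * (1 + real K)"
proof -
  have "(\<Sum>j\<in>{1..K}. explore_weight K yhat j) \<le> (\<Sum>j\<in>{1..K}. 1 + real K)"
    using assms by (intro sum_mono) (auto simp: explore_weight_def d_max_def)
  then show ?thesis by simp
qed

lemma sum_explore_weight_pos:
  assumes "yhat \<in> {1..K}"
  shows "0 < (\<Sum>j\<in>{1..K}. explore_weight K yhat j)"
  using assms explore_weight_pos by (intro sum_pos) auto

lemma sample_prob_pos:
  assumes "yhat \<in> {1..K}" "i \<in> {1..K}" "0 < \<gamma>" "\<gamma> \<le> 1"
  shows "0 < sample_prob K \<gamma> yhat i"
  unfolding sample_prob_def explore_prob_def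
  using assms explore_weight_pos[OF assms(1,2)] sum_explore_weight_pos[OF assms(1)]
  by (intro add_nonneg_pos mult_nonneg_nonneg mult_pos_pos divide_pos_pos) auto

text \<open>This controls the variance of the importance weights. The index \<open>K\<close> is left
  out because the estimate vanishes there.\<close>

lemma sum_inverse_sample_prob_le:
  assumes "yhat \<in> {1..K}" "0 < \<gamma>" "\<gamma> \<le> 1"
  shows "(\<Sum>i\<in>{1..<K}. 1 / sample_prob K \<gamma> yhat i) \<le> 3 * (real K)\<^sup>2 * ln (real K) / \<gamma>"
proof (cases "K \<ge> 2")
  case True
  define Z where "Z = (\<Sum>j\<in>{1..K}. explore_weight K yhat j)"
  have Z: "0 < Z" "Z \<le> real K * (1 + real K)"
    using sum_explore_weight_pos sum_explore_weight_le assms(1) unfolding Z_def by auto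
  have "1 / sample_prob K \<gamma> yhat i \<le> Z / \<gamma> * (1 / (1 + real i) + 1 / (1 + real (K - i)))"
    if i: "i \<in> {1..<K}" for i
  proof -
    have e: "0 < explore_weight K yhat i"
      using explore_weight_pos assms(1) i by auto
    \<comment> \<open>The greedy part \<open>(1 - \<gamma>) * of_bool (i = yhat)\<close> is
      nonnegative and is dropped.\<close>
    have "1 / sample_prob K \<gamma> yhat i \<le> 1 / (\<gamma> * (explore_weight K yhat i / Z))"
    proof (intro divide_left_mono)
      show "\<gamma> * (explore_weight K yhat i / Z) \<le> sample_prob K \<gamma> yhat i"
        unfolding sample_prob_def explore_prob_def Z_def[symmetric] using assms by simp
      show "0 < sample_prob K \<gamma> yhat i * (\<gamma> * (explore_weight K yhat i / Z))"
        using sample_prob_pos[of yhat K i \<gamma>] assms e Z i by simp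
    qed simp
    also have "\<dots> = Z / \<gamma> * (1 / explore_weight K yhat i)"
      using assms e Z by (simp add: field_simps)
    also have "\<dots> \<le> Z / \<gamma> * (1 / (1 + real i) + 1 / (1 + real (K - i)))"
    proof (rule mult_left_mono)
      have "1 / explore_weight K yhat i \<le> 1 / min (1 + real i) (1 + real (K - i))"
        using explore_weight_ge[OF assms(1) i] e by (intro divide_left_mono) auto
      also have "\<dots> \<le> 1 / (1 + real i) + 1 / (1 + real (K - i))"
        by (auto simp: min_def)
      finally show "1 / explore_weight K yhat i \<le> 1 / (1 + real i) + 1 / (1 + real (K - i))" .
    qed (use Z assms in simp)
    finally show ?thesis .
  qed
  then have "(\<Sum>i\<in>{1..<K}. 1 / sample_prob K \<gamma> yhat i) \<le>
      (\<Sum>i\<in>{1..<K}. Z / \<gamma> * (1 / (1 + real i) + 1 / (1 + real (K - i))))"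
    by (rule sum_mono)
  also have "\<dots> = Z / \<gamma> * ((\<Sum>i\<in>{1..<K}. 1 / (1 + real i)) + (\<Sum>i\<in>{1..<K}. 1 / (1 + real (K - i))))"
    by (simp only: sum_distrib_left[symmetric] sum.distrib)
  \<comment> \<open>Reflecting the indices identifies the sum measured from the right end with the
    one measured from the left.\<close>
  also have "(\<Sum>i\<in>{1..<K}. 1 / (1 + real (K - i))) = (\<Sum>i\<in>{1..<K}. 1 / (1 + real i))"
    by (rule sum.reindex_bij_witness[of _ "\<lambda>i. K - i" "\<lambda>i. K - i"]) auto
  \<comment> \<open>The terms run from 1/2 to \<open>1 / K\<close>. The missing first harmonic term
    cancels the 1 in \<open>harm_le_ln\<close>, leaving a pure multiple of
    \<open>ln K\<close>.\<close>
  also have "(\<Sum>i\<in>{1..<K}. 1 / (1 + real i)) = harm K - 1"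
  proof -
    have "harm K = 1 + (\<Sum>i\<in>{1..<K}. inverse (real (Suc i)))"
      using True sum.shift_bounds_Suc_ivl[of "\<lambda>i. inverse (real i)" 1 K]
        sum.atLeast_Suc_atMost[of 1 K "\<lambda>i. inverse (real i)"]
      by (simp add: harm_def atLeastLessThanSuc_atLeastAtMost)
    then show ?thesis by (simp add: inverse_eq_divide)
  qed
  also have "Z / \<gamma> * (harm K - 1 + (harm K - 1)) \<le> Z / \<gamma> * (2 * ln (real K))"
    using harm_le_ln[of K] True Z assms by (intro mult_left_mono) auto
  \<comment> \<open>From \<open>K \<ge> 2\<close>, the term linear in \<open>K\<close> is at most
    half of \<open>K * K\<close>. The factor 3/2 and the two harmonic sums make the constant
    3.\<close>
  also have "\<dots> \<le> (3 / 2 * (real K)\<^sup>2) / \<gamma> * (2 * ln (real K))"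
  proof (intro mult_right_mono divide_right_mono)
    have "real K * 2 \<le> real K * real K" using True by (intro mult_left_mono) auto
    then show "Z \<le> 3 / 2 * (real K)\<^sup>2"
      using Z by (simp add: power2_eq_square algebra_simps)
  qed (use True assms in auto)
  finally show ?thesis by (simp add: mult_ac)
next
  case False
  \<comment> \<open>Both sides are 0: the sum is empty and \<open>ln 1 = 0\<close>.\<close>
  then have "K = 1" using assms by auto
  then show ?thesis by simp
qed

lemma expectation_sample_pmf:
  fixes f :: "nat \<Rightarrow> real"
  assumes "yhat \<in> {1..K}" "0 < \<gamma>" "\<gamma> \<le> 1"
  shows "measure_pmf.expectation (sample_pmf K \<gamma> yhat) f =
         (\<Sum>k\<in>{1..K}. sample_prob K \<gamma> yhat k * f k)"
  by (subst integral_measure_pmf[where A = "{1..K}"])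
    (auto simp: pmf_sample_pmf[OF assms] set_pmf_eq split: if_splits)

lemma sum_sample_prob:
  assumes "yhat \<in> {1..K}" "0 < \<gamma>" "\<gamma> \<le> 1"
  shows "(\<Sum>k\<in>{1..K}. sample_prob K \<gamma> yhat k) = 1"
  using expectation_sample_pmf[OF assms, of "\<lambda>_. 1"] by simp

lemma finite_set_sample_pmf:
  assumes "yhat \<in> {1..K}" "0 < \<gamma>" "\<gamma> \<le> 1"
  shows "finite (set_pmf (sample_pmf K \<gamma> yhat))"
  by (rule finite_subset[of _ "{1..K}"])
    (auto simp: set_pmf_eq pmf_sample_pmf[OF assms] split: if_splits)

section \<open>Euclidean quantities and the loss in real arithmetic\<close>

text \<open>The sums stop before \<open>K\<close>, since the comparator is an arbitrary function
  outside the thresholds \<open>1, ..., K - 1\<close>.\<close>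

definition sq_norm :: "nat \<Rightarrow> 'd::finite param \<Rightarrow> real" where
  "sq_norm K u = (norm (fst u))\<^sup>2 + (\<Sum>i\<in>{1..<K}. (snd u i)\<^sup>2)"

definition sq_dist :: "nat \<Rightarrow> 'd::finite param \<Rightarrow> 'd param \<Rightarrow> real" where
  "sq_dist K u c = (norm (fst u - fst c))\<^sup>2 + (\<Sum>i\<in>{1..<K}. (snd u i - snd c i)\<^sup>2)"

text \<open>
  A junk value at \<open>i = K\<close>, where it is only ever multiplied by \<open>tau_tilde\<close>, which vanishes there.
\<close>

definition real_margin :: "'d::finite param \<Rightarrow> real ^ 'd \<Rightarrow> nat \<Rightarrow> real" where
  "real_margin u xt i = fst u \<bullet> xt - snd u i"

lemma sq_norm_nonneg: "0 \<le> sq_norm K u" and sq_dist_nonneg: "0 \<le> sq_dist K u c"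
  by (simp_all add: sq_norm_def sq_dist_def sum_nonneg)

lemma reg_loss_eq:
  assumes "yt \<in> {1..K}"
  shows "reg_loss K lam u xt yt = lam / 2 * sq_norm K u +
           (\<Sum>i\<in>{1..<K}. max 0 (- label_sign yt i * real_margin u xt i))"
proof -
  have K: "{1..K} = insert K {1..<K}" using assms by auto
  have "real_of_ereal (max 0 (- ereal (label_sign yt i) * margin K u xt i)) =
      max 0 (- label_sign yt i * real_margin u xt i)" if "i \<in> {1..<K}" for i
    using that by (auto simp: margin_def threshold_def real_margin_def max_def zero_ereal_def)
  \<comment> \<open>As \<open>yt \<le> K\<close>, the sign at \<open>K\<close> is -1 and the margin
    is \<open>-\<infinity>\<close>, so the maximum is attained by 0.\<close>
  moreover have "real_of_ereal (max 0 (- ereal (label_sign yt K) * margin K u xt K)) = 0"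
    using assms by (auto simp: margin_def threshold_def label_sign_def max_def)
  ultimately show ?thesis
    unfolding reg_loss_def sq_norm_def K by simp
qed

section \<open>First and second moments of the gradient estimate\<close>

text \<open>The feedback at the sampled index is exactly \<open>label_sign\<close>, and division by
  a positive probability does not affect the sign test in the indicator.\<close>

lemma tau_tilde_less:
  assumes "i \<in> {1..<K}" "0 < \<gamma>" "\<gamma> \<le> 1"
  shows "tau_tilde K \<gamma> u xt yt i i =
    label_sign yt i / sample_prob K \<gamma> (predicted_label K u xt) i *
      of_bool (label_sign yt i * real_margin u xt i \<le> 0)"
proof -
  define P where "P = sample_prob K \<gamma> (predicted_label K u xt) i"
  have "0 < P"
    unfolding P_def using assms by (intro sample_prob_pos predicted_label_in) auto
  then show ?thesis
    using assms unfolding tau_tilde_def z_tilde_def P_def[symmetric]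
    by (auto simp: label_sign_def margin_def threshold_def real_margin_def field_simps
        zero_ereal_def of_bool_def)
qed

text \<open>At \<open>K\<close> the feedback is negative and the margin is
  \<open>-\<infinity>\<close>, so their product is \<open>\<infinity>\<close> and the indicator is
  0.\<close>

lemma tau_tilde_last:
  assumes "yt \<in> {1..K}" "0 < \<gamma>" "\<gamma> \<le> 1"
  shows "tau_tilde K \<gamma> u xt yt K K = 0"
proof -
  define P where "P = sample_prob K \<gamma> (predicted_label K u xt) K"
  have "0 < P"
    unfolding P_def using assms by (intro sample_prob_pos predicted_label_in) auto
  then show ?thesis
    using assms unfolding tau_tilde_def z_tilde_def P_def[symmetric]
    by (auto simp: margin_def threshold_def)
qed

text \<open>Convexity of the hinge as a function of the margin: its slope at \<open>m\<close> may be
  taken as \<open>- z\<close> if \<open>z * m \<le> 0\<close>, kink included, and as 0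
  otherwise.\<close>

lemma hinge_subgradient:
  fixes m m' z :: real
  shows "z * of_bool (z * m \<le> 0) * (m - m') \<le> max 0 (- z * m') - max 0 (- z * m)"
  by (cases "z * m \<le> 0") (auto simp: algebra_simps max_def)

lemma expectation_tau_tilde_le:
  fixes u c :: "'d::finite param" and xt :: "real ^ 'd"
  assumes "yt \<in> {1..K}" "0 < \<gamma>" "\<gamma> \<le> 1"
  defines "yhat \<equiv> predicted_label K u xt"
  shows "(\<Sum>k\<in>{1..K}. sample_prob K \<gamma> yhat k *
            (tau_tilde K \<gamma> u xt yt k k * (real_margin u xt k - real_margin c xt k)))
         \<le> (\<Sum>i\<in>{1..<K}. max 0 (- label_sign yt i * real_margin c xt i)) -
           (\<Sum>i\<in>{1..<K}. max 0 (- label_sign yt i * real_margin u xt i))"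
    (is "(\<Sum>k\<in>_. ?f k) \<le> _")
proof -
  have K: "{1..K} = insert K {1..<K}" using assms by auto
  have P: "0 < sample_prob K \<gamma> yhat i" if "i \<in> {1..K}" for i
    unfolding yhat_def using assms that by (intro sample_prob_pos predicted_label_in) auto
  have "(\<Sum>k\<in>{1..K}. ?f k) = (\<Sum>k\<in>{1..<K}. ?f k)"
    unfolding K using tau_tilde_last[OF assms(1-3), of u xt] by simp
  also have "\<dots> \<le> (\<Sum>i\<in>{1..<K}. max 0 (- label_sign yt i * real_margin c xt i) -
        max 0 (- label_sign yt i * real_margin u xt i))"
  proof (rule sum_mono)
    fix i assume i: "i \<in> {1..<K}"
    \<comment> \<open>Importance weighting: the sampling probability cancels against the denominator
      of the estimate.\<close>
    have "?f i = label_sign yt i * of_bool (label_sign yt i * real_margin u xt i \<le> 0) *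
        (real_margin u xt i - real_margin c xt i)"
      using P[of i] i by (simp add: tau_tilde_less[OF i assms(2,3)] yhat_def[symmetric])
    then show "?f i \<le> max 0 (- label_sign yt i * real_margin c xt i) -
        max 0 (- label_sign yt i * real_margin u xt i)"
      by (simp only: hinge_subgradient)
  qed
  finally show ?thesis by (simp add: sum_subtractf)
qed

lemma expectation_tau_tilde_sq_le:
  fixes u :: "'d::finite param" and xt :: "real ^ 'd"
  assumes "yt \<in> {1..K}" "0 < \<gamma>" "\<gamma> \<le> 1"
  defines "yhat \<equiv> predicted_label K u xt"
  shows "(\<Sum>k\<in>{1..K}. sample_prob K \<gamma> yhat k * (tau_tilde K \<gamma> u xt yt k k)\<^sup>2)
         \<le> 3 * (real K)\<^sup>2 * ln (real K) / \<gamma>" (is "(\<Sum>k\<in>_. ?f k) \<le> _")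
proof -
  have K: "{1..K} = insert K {1..<K}" using assms by auto
  have yhat: "yhat \<in> {1..K}" unfolding yhat_def using assms by (intro predicted_label_in) auto
  have "(\<Sum>k\<in>{1..K}. ?f k) = (\<Sum>k\<in>{1..<K}. ?f k)"
    unfolding K using tau_tilde_last[OF assms(1-3), of u xt] by simp
  \<comment> \<open>The squared estimate carries two inverse probabilities, of which only one is
    cancelled; the indicator is bounded by 1.\<close>
  also have "\<dots> \<le> (\<Sum>i\<in>{1..<K}. 1 / sample_prob K \<gamma> yhat i)"
  proof (rule sum_mono)
    fix i assume i: "i \<in> {1..<K}"
    have "0 < sample_prob K \<gamma> yhat i" using sample_prob_pos yhat assms i by auto
    then show "?f i \<le> 1 / sample_prob K \<gamma> yhat i"
      by (simp add: tau_tilde_less[OF i assms(2,3)] yhat_def[symmetric] label_sign_def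
          power2_eq_square of_bool_def)
  qed
  also have "\<dots> \<le> 3 * (real K)\<^sup>2 * ln (real K) / \<gamma>"
    by (rule sum_inverse_sample_prob_le[OF yhat assms(2,3)])
  finally show ?thesis .
qed

section \<open>One deterministic gradient step\<close>

text \<open>Expansion of the square for a step along \<open>g = lam * a - \<tau> * v\<close>, the
  gradient at \<open>a\<close> of the regularizer minus a linear term. A general inner product space
  lets the same inequality serve \<open>w\<close> and each real threshold.\<close>

lemma sgd_step_dist:
  fixes a c v :: "'a::real_inner" and lam t \<tau> :: real
  assumes "lam > 0" "t > 0"
  shows "lam * t / 2 * (norm ((1 - 1 / (lam * t) * lam) *\<^sub>R a + (1 / (lam * t) * \<tau>) *\<^sub>R v - c))\<^sup>2
    \<le> lam * (t - 1) / 2 * (norm (a - c))\<^sup>2 - lam / 2 * ((norm a)\<^sup>2 - (norm c)\<^sup>2)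
      + \<tau> * (v \<bullet> (a - c)) + (lam\<^sup>2 * (norm a)\<^sup>2 + \<tau>\<^sup>2 * (norm v)\<^sup>2) / (lam * t)"
proof -
  define g where "g = lam *\<^sub>R a - \<tau> *\<^sub>R v"
  define s where "s = lam * t"
  have s: "s > 0" using assms by (simp add: s_def)
  have step: "(1 - 1 / (lam * t) * lam) *\<^sub>R a + (1 / (lam * t) * \<tau>) *\<^sub>R v - c = (a - c) - (1 / s) *\<^sub>R g"
    by (simp add: g_def s_def algebra_simps)
  have "lam * t / 2 * (norm ((1 - 1 / (lam * t) * lam) *\<^sub>R a + (1 / (lam * t) * \<tau>) *\<^sub>R v - c))\<^sup>2
      = s / 2 * (norm ((a - c) - (1 / s) *\<^sub>R g))\<^sup>2"
    unfolding step by (simp add: s_def)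
  also have "\<dots> = s / 2 * (norm (a - c))\<^sup>2 - g \<bullet> (a - c) + (norm g)\<^sup>2 / (2 * s)"
    unfolding power2_norm_eq_inner inner_diff_left[of "a - c"]
      inner_diff_right[of _ "a - c"]
    using s by (simp add: field_simps inner_commute)
  \<comment> \<open>Polarization. The term \<open>lam / 2 * (norm (a - c))\<^sup>2\<close>, the gain
    from strong convexity, lowers the weight from \<open>t\<close> to \<open>t - 1\<close>, which
    makes successive rounds telescope.\<close>
  also have "g \<bullet> (a - c) = lam / 2 * ((norm a)\<^sup>2 - (norm c)\<^sup>2 + (norm (a - c))\<^sup>2) - \<tau> * (v \<bullet> (a - c))"
    unfolding g_def power2_norm_eq_inner
    by (simp add: inner_diff_left inner_diff_right inner_commute field_simps)
  \<comment> \<open>The parallelogram law separates the two parts of \<open>g\<close>; its factor 2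
    cancels the one in \<open>2 * s\<close>.\<close>
  also have "(norm g)\<^sup>2 / (2 * s) \<le> (lam\<^sup>2 * (norm a)\<^sup>2 + \<tau>\<^sup>2 * (norm v)\<^sup>2) / s"
  proof -
    have "(norm g)\<^sup>2 + (norm (lam *\<^sub>R a + \<tau> *\<^sub>R v))\<^sup>2 =
        2 * (lam\<^sup>2 * (norm a)\<^sup>2 + \<tau>\<^sup>2 * (norm v)\<^sup>2)"
      unfolding g_def power2_norm_eq_inner
      by (simp add: inner_diff_left inner_diff_right inner_add_left inner_add_right inner_commute
          power2_eq_square algebra_simps)
    then have "(norm g)\<^sup>2 \<le> 2 * (lam\<^sup>2 * (norm a)\<^sup>2 + \<tau>\<^sup>2 * (norm v)\<^sup>2)"
      by (smt (verit) zero_le_power2)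
    then show ?thesis using s by (simp add: field_simps)
  qed
  finally show ?thesis by (simp add: s_def algebra_simps diff_divide_distrib)
qed

text \<open>After scaling by \<open>lam\<close>, the step is a convex combination of
  \<open>lam * a\<close> and \<open>\<tau> * v\<close> with weights \<open>1 - 1 / t\<close> and
  \<open>1 / t\<close>, so convexity of the squared norm applies.\<close>

lemma sgd_step_norm:
  fixes a v :: "'a::real_inner" and lam t \<tau> :: real
  assumes "lam > 0" "t \<ge> 1"
  shows "lam\<^sup>2 * (norm ((1 - 1 / (lam * t) * lam) *\<^sub>R a + (1 / (lam * t) * \<tau>) *\<^sub>R v))\<^sup>2
    \<le> (1 - 1 / t) * (lam\<^sup>2 * (norm a)\<^sup>2) + 1 / t * (\<tau>\<^sup>2 * (norm v)\<^sup>2)"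
proof -
  define r where "r = 1 / t"
  define p where "p = lam *\<^sub>R a"
  define q where "q = \<tau> *\<^sub>R v"
  have r: "0 \<le> r" "r \<le> 1" using assms by (auto simp: r_def)
  have "lam *\<^sub>R ((1 - 1 / (lam * t) * lam) *\<^sub>R a + (1 / (lam * t) * \<tau>) *\<^sub>R v)
      = (1 - r) *\<^sub>R p + r *\<^sub>R q"
    using assms by (simp add: r_def p_def q_def algebra_simps)
  then have "lam\<^sup>2 * (norm ((1 - 1 / (lam * t) * lam) *\<^sub>R a + (1 / (lam * t) * \<tau>) *\<^sub>R v))\<^sup>2
      = (norm ((1 - r) *\<^sub>R p + r *\<^sub>R q))\<^sup>2"
    by (metis norm_scaleR power_mult_distrib power2_abs)
  also have "\<dots> = (1 - r) * (norm p)\<^sup>2 + r * (norm q)\<^sup>2 - r * (1 - r) * (norm (p - q))\<^sup>2"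
    unfolding power2_norm_eq_inner
    by (simp add: inner_diff_left inner_diff_right inner_add_left inner_add_right inner_commute
        algebra_simps)
  also have "\<dots> \<le> (1 - r) * (norm p)\<^sup>2 + r * (norm q)\<^sup>2"
    using r by simp
  finally show ?thesis by (simp add: r_def p_def q_def power_mult_distrib)
qed

text \<open>The squared distance splits over \<open>w\<close> and the single thresholds. Each block
  performs a step of the form in \<open>sgd_step_dist\<close> with a common \<tau>, so the block
  inequalities add up.\<close>

lemma dford_step_dist:
  fixes u c :: "'d::finite param" and xt :: "real ^ 'd"
  assumes "lam > 0" "t \<ge> 1" "yt \<in> {1..K}" "k \<in> {1..K}" "0 < \<gamma>" "\<gamma> \<le> 1" "norm xt \<le> R"
  defines "\<tau> \<equiv> tau_tilde K \<gamma> u xt yt k k"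
  shows "lam * real t / 2 * sq_dist K (dford_step K lam \<gamma> t xt yt k u) c
    \<le> lam * (real t - 1) / 2 * sq_dist K u c - lam / 2 * (sq_norm K u - sq_norm K c)
      + \<tau> * (real_margin u xt k - real_margin c xt k)
      + (lam\<^sup>2 * sq_norm K u + \<tau>\<^sup>2 * (R\<^sup>2 + 1)) / (lam * real t)"
proof -
  \<comment> \<open>For \<open>k < K\<close> the pair \<open>(xt, e)\<close> is the gradient of the
    \<open>k\<close>-th margin. For \<open>k = K\<close> the direction \<open>e\<close> vanishes on
    the summation range.\<close>
  define e :: "nat \<Rightarrow> real" where "e i = - of_bool (i = k)" for i
  have "lam * real t / 2 * sq_dist K (dford_step K lam \<gamma> t xt yt k u) c =
    lam * real t / 2 * (norm ((1 - 1 / (lam * real t) * lam) *\<^sub>R fst u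
      + (1 / (lam * real t) * \<tau>) *\<^sub>R xt - fst c))\<^sup>2
    + (\<Sum>i\<in>{1..<K}. lam * real t / 2 * (norm ((1 - 1 / (lam * real t) * lam) *\<^sub>R snd u i
      + (1 / (lam * real t) * \<tau>) *\<^sub>R e i - snd c i))\<^sup>2)"
    unfolding sq_dist_def dford_step_def Let_def \<tau>_def[symmetric] distrib_left sum_distrib_left
    by (intro arg_cong2[where f = "(+)"] sum.cong) (auto simp: e_def)
  also have "\<dots> \<le> (lam * (real t - 1) / 2 * (norm (fst u - fst c))\<^sup>2
        - lam / 2 * ((norm (fst u))\<^sup>2 - (norm (fst c))\<^sup>2)
        + \<tau> * (xt \<bullet> (fst u - fst c))
        + (lam\<^sup>2 * (norm (fst u))\<^sup>2 + \<tau>\<^sup>2 * (norm xt)\<^sup>2) / (lam * real t))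
      + (\<Sum>i\<in>{1..<K}. lam * (real t - 1) / 2 * (norm (snd u i - snd c i))\<^sup>2
        - lam / 2 * ((norm (snd u i))\<^sup>2 - (norm (snd c i))\<^sup>2)
        + \<tau> * (e i \<bullet> (snd u i - snd c i))
        + (lam\<^sup>2 * (norm (snd u i))\<^sup>2 + \<tau>\<^sup>2 * (norm (e i))\<^sup>2) / (lam * real t))"
    using assms by (intro add_mono sum_mono sgd_step_dist) auto
  also have "\<dots> = lam * (real t - 1) / 2 * sq_dist K u c - lam / 2 * (sq_norm K u - sq_norm K c)
      + \<tau> * (xt \<bullet> (fst u - fst c) + (\<Sum>i\<in>{1..<K}. e i * (snd u i - snd c i)))
      + (lam\<^sup>2 * sq_norm K u + \<tau>\<^sup>2 * ((norm xt)\<^sup>2 + (\<Sum>i\<in>{1..<K}. (e i)\<^sup>2))) / (lam * real t)"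
    by (simp add: sq_dist_def sq_norm_def sum.distrib sum_subtractf sum_distrib_left[symmetric]
        sum_divide_distrib[symmetric] distrib_left right_diff_distrib add_divide_distrib)
  also have "\<tau> * (xt \<bullet> (fst u - fst c) + (\<Sum>i\<in>{1..<K}. e i * (snd u i - snd c i)))
      = \<tau> * (real_margin u xt k - real_margin c xt k)"
  proof (cases "k = K")
    \<comment> \<open>The junk entries at \<open>K\<close> appear in \<open>real_margin\<close>
      here, but \<tau> is 0.\<close>
    case True
    then show ?thesis using tau_tilde_last[OF assms(3,5,6), of u xt] by (simp add: \<tau>_def)
  next
    case False
    then have "(\<Sum>i\<in>{1..<K}. e i * (snd u i - snd c i)) = - (snd u k - snd c k)"
      using assms(4) by (simp add: e_def of_bool_def if_distrib if_distribR sum.delta cong: if_cong)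
    then show ?thesis
      by (simp add: real_margin_def inner_diff_right inner_commute)
  qed
  also have "(lam\<^sup>2 * sq_norm K u + \<tau>\<^sup>2 * ((norm xt)\<^sup>2 + (\<Sum>i\<in>{1..<K}. (e i)\<^sup>2))) / (lam * real t)
      \<le> (lam\<^sup>2 * sq_norm K u + \<tau>\<^sup>2 * (R\<^sup>2 + 1)) / (lam * real t)"
  proof (intro divide_right_mono add_left_mono mult_left_mono add_mono)
    show "(norm xt)\<^sup>2 \<le> R\<^sup>2" using assms by (intro power_mono) auto
    show "(\<Sum>i\<in>{1..<K}. (e i)\<^sup>2) \<le> 1"
      by (auto simp: e_def of_bool_def if_distrib if_distribR sum.delta cong: if_cong)
  qed (use assms in auto)
  finally show ?thesis by simp
qed

lemma dford_step_norm:
  fixes u :: "'d::finite param" and xt :: "real ^ 'd" and yt :: nat and \<gamma> :: real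
  assumes "lam > 0" "t \<ge> 1" "k \<in> {1..K}" "norm xt \<le> R"
  defines "\<tau> \<equiv> tau_tilde K \<gamma> u xt yt k k"
  shows "lam\<^sup>2 * sq_norm K (dford_step K lam \<gamma> t xt yt k u)
    \<le> (1 - 1 / real t) * (lam\<^sup>2 * sq_norm K u) + 1 / real t * (\<tau>\<^sup>2 * (R\<^sup>2 + 1))"
proof -
  define e :: "nat \<Rightarrow> real" where "e i = - of_bool (i = k)" for i
  have "lam\<^sup>2 * sq_norm K (dford_step K lam \<gamma> t xt yt k u) =
    lam\<^sup>2 * (norm ((1 - 1 / (lam * real t) * lam) *\<^sub>R fst u + (1 / (lam * real t) * \<tau>) *\<^sub>R xt))\<^sup>2
    + (\<Sum>i\<in>{1..<K}. lam\<^sup>2 * (norm ((1 - 1 / (lam * real t) * lam) *\<^sub>R snd u i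
      + (1 / (lam * real t) * \<tau>) *\<^sub>R e i))\<^sup>2)"
    unfolding sq_norm_def dford_step_def Let_def \<tau>_def[symmetric] distrib_left sum_distrib_left
    by (intro arg_cong2[where f = "(+)"] sum.cong) (auto simp: e_def)
  also have "\<dots> \<le> ((1 - 1 / real t) * (lam\<^sup>2 * (norm (fst u))\<^sup>2)
        + 1 / real t * (\<tau>\<^sup>2 * (norm xt)\<^sup>2))
      + (\<Sum>i\<in>{1..<K}. (1 - 1 / real t) * (lam\<^sup>2 * (norm (snd u i))\<^sup>2)
        + 1 / real t * (\<tau>\<^sup>2 * (norm (e i))\<^sup>2))"
    using assms by (intro add_mono sum_mono sgd_step_norm) auto
  also have "\<dots> = (1 - 1 / real t) * (lam\<^sup>2 * sq_norm K u)
      + 1 / real t * (\<tau>\<^sup>2 * ((norm xt)\<^sup>2 + (\<Sum>i\<in>{1..<K}. (e i)\<^sup>2)))"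
    by (simp only: sq_norm_def sum.distrib sum_distrib_left[symmetric] distrib_left
        real_norm_def power2_abs add_ac)
  also have "\<dots> \<le> (1 - 1 / real t) * (lam\<^sup>2 * sq_norm K u) + 1 / real t * (\<tau>\<^sup>2 * (R\<^sup>2 + 1))"
  proof (intro add_left_mono mult_left_mono add_mono)
    show "(norm xt)\<^sup>2 \<le> R\<^sup>2" using assms by (intro power_mono) auto
    show "(\<Sum>i\<in>{1..<K}. (e i)\<^sup>2) \<le> 1"
      by (auto simp: e_def of_bool_def if_distrib if_distribR sum.delta cong: if_cong)
  qed (use assms in auto)
  finally show ?thesis .
qed

section \<open>One round in expectation over the sampled label\<close>

text \<open>Averaging turns the term linear in \<tau> into at most a difference of hinge losses.
  Together with the regularizers this is the regret of the round, with negative sign.\<close>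

lemma expectation_dford_step_dist:
  fixes u c :: "'d::finite param" and xt :: "real ^ 'd"
  assumes "lam > 0" "t \<ge> 1" "yt \<in> {1..K}" "0 < \<gamma>" "\<gamma> \<le> 1" "norm xt \<le> R"
  shows "measure_pmf.expectation (sample_pmf K \<gamma> (predicted_label K u xt))
      (\<lambda>k. lam * real t / 2 * sq_dist K (dford_step K lam \<gamma> t xt yt k u) c)
    \<le> lam * (real t - 1) / 2 * sq_dist K u c - (reg_loss K lam u xt yt - reg_loss K lam c xt yt)
      + (lam\<^sup>2 * sq_norm K u + 3 * (real K)\<^sup>2 * ln (real K) / \<gamma> * (R\<^sup>2 + 1)) / (lam * real t)"
proof -
  define yhat where "yhat = predicted_label K u xt"
  have yhat: "yhat \<in> {1..K}"
    unfolding yhat_def using assms by (intro predicted_label_in) auto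
  define P where "P = sample_prob K \<gamma> yhat"
  define \<tau> where "\<tau> k = tau_tilde K \<gamma> u xt yt k k" for k
  \<comment> \<open>\<open>A\<close> collects everything independent of the sampled label, leaving
    only the first and second moments of \<tau> to average.\<close>
  define A where "A = lam * (real t - 1) / 2 * sq_dist K u c - lam / 2 * (sq_norm K u - sq_norm K c)
      + lam\<^sup>2 * sq_norm K u / (lam * real t)"
  define m where "m k = real_margin u xt k - real_margin c xt k" for k
  have "measure_pmf.expectation (sample_pmf K \<gamma> yhat)
      (\<lambda>k. lam * real t / 2 * sq_dist K (dford_step K lam \<gamma> t xt yt k u) c)
    = (\<Sum>k\<in>{1..K}. P k * (lam * real t / 2 * sq_dist K (dford_step K lam \<gamma> t xt yt k u) c))"
    unfolding P_def by (rule expectation_sample_pmf[OF yhat assms(4,5)])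
  also have "\<dots> \<le> (\<Sum>k\<in>{1..K}. P k * (A + \<tau> k * m k + (\<tau> k)\<^sup>2 * ((R\<^sup>2 + 1) / (lam * real t))))"
  proof (intro sum_mono mult_left_mono)
    fix k assume k: "k \<in> {1..K}"
    show "lam * real t / 2 * sq_dist K (dford_step K lam \<gamma> t xt yt k u) c
      \<le> A + \<tau> k * m k + (\<tau> k)\<^sup>2 * ((R\<^sup>2 + 1) / (lam * real t))"
      using dford_step_dist[OF assms(1-3) k assms(4-6), of u c]
      by (simp only: A_def \<tau>_def m_def add_divide_distrib times_divide_eq_right
          distrib_left mult_1_right add_ac)
    show "0 \<le> P k"
      unfolding P_def using sample_prob_pos[OF yhat k assms(4,5)] by simp
  qed
  also have "\<dots> = A * (\<Sum>k\<in>{1..K}. P k) + (\<Sum>k\<in>{1..K}. P k * (\<tau> k * m k))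
      + (\<Sum>k\<in>{1..K}. P k * (\<tau> k)\<^sup>2) * ((R\<^sup>2 + 1) / (lam * real t))"
    by (simp only: sum_distrib_left sum_distrib_right sum.distrib[symmetric] distrib_left mult_ac)
  also have "\<dots> \<le> A * 1 + ((\<Sum>i\<in>{1..<K}. max 0 (- label_sign yt i * real_margin c xt i)) -
           (\<Sum>i\<in>{1..<K}. max 0 (- label_sign yt i * real_margin u xt i)))
      + 3 * (real K)\<^sup>2 * ln (real K) / \<gamma> * ((R\<^sup>2 + 1) / (lam * real t))"
    using expectation_tau_tilde_le[OF assms(3-5), of u xt c]
      expectation_tau_tilde_sq_le[OF assms(3-5), of u xt] sum_sample_prob[OF yhat assms(4,5)] assms
    by (intro add_mono mult_right_mono) (auto simp: P_def yhat_def \<tau>_def m_def)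
  also have "\<dots> = lam * (real t - 1) / 2 * sq_dist K u c
      - (reg_loss K lam u xt yt - reg_loss K lam c xt yt)
      + (lam\<^sup>2 * sq_norm K u + 3 * (real K)\<^sup>2 * ln (real K) / \<gamma> * (R\<^sup>2 + 1)) / (lam * real t)"
    unfolding reg_loss_eq[OF assms(3)] A_def
      add_divide_distrib[of "lam\<^sup>2 * sq_norm K u"] times_divide_eq_right
    by (simp add: right_diff_distrib)
  finally show ?thesis unfolding yhat_def .
qed

lemma expectation_dford_step_norm:
  fixes u :: "'d::finite param" and xt :: "real ^ 'd"
  assumes "lam > 0" "t \<ge> 1" "yt \<in> {1..K}" "0 < \<gamma>" "\<gamma> \<le> 1" "norm xt \<le> R"
  shows "measure_pmf.expectation (sample_pmf K \<gamma> (predicted_label K u xt))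
      (\<lambda>k. lam\<^sup>2 * sq_norm K (dford_step K lam \<gamma> t xt yt k u))
    \<le> (1 - 1 / real t) * (lam\<^sup>2 * sq_norm K u)
      + 1 / real t * (3 * (real K)\<^sup>2 * ln (real K) / \<gamma> * (R\<^sup>2 + 1))"
proof -
  define yhat where "yhat = predicted_label K u xt"
  have yhat: "yhat \<in> {1..K}"
    unfolding yhat_def using assms by (intro predicted_label_in) auto
  define P where "P = sample_prob K \<gamma> yhat"
  define \<tau> where "\<tau> k = tau_tilde K \<gamma> u xt yt k k" for k
  define A where "A = (1 - 1 / real t) * (lam\<^sup>2 * sq_norm K u)"
  have "measure_pmf.expectation (sample_pmf K \<gamma> yhat)
      (\<lambda>k. lam\<^sup>2 * sq_norm K (dford_step K lam \<gamma> t xt yt k u))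
    = (\<Sum>k\<in>{1..K}. P k * (lam\<^sup>2 * sq_norm K (dford_step K lam \<gamma> t xt yt k u)))"
    unfolding P_def by (rule expectation_sample_pmf[OF yhat assms(4,5)])
  also have "\<dots> \<le> (\<Sum>k\<in>{1..K}. P k * (A + 1 / real t * ((\<tau> k)\<^sup>2 * (R\<^sup>2 + 1))))"
  proof (intro sum_mono mult_left_mono)
    fix k assume k: "k \<in> {1..K}"
    show "lam\<^sup>2 * sq_norm K (dford_step K lam \<gamma> t xt yt k u)
      \<le> A + 1 / real t * ((\<tau> k)\<^sup>2 * (R\<^sup>2 + 1))"
      unfolding A_def \<tau>_def by (rule dford_step_norm[OF assms(1,2) k assms(6)])
    show "0 \<le> P k"
      unfolding P_def using sample_prob_pos[OF yhat k assms(4,5)] by simp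
  qed
  also have "\<dots> = A * (\<Sum>k\<in>{1..K}. P k)
      + 1 / real t * ((\<Sum>k\<in>{1..K}. P k * (\<tau> k)\<^sup>2) * (R\<^sup>2 + 1))"
    by (simp only: sum_distrib_left sum_distrib_right sum.distrib[symmetric] distrib_left mult_ac)
  also have "\<dots> \<le> A * 1 + 1 / real t * (3 * (real K)\<^sup>2 * ln (real K) / \<gamma> * (R\<^sup>2 + 1))"
    using expectation_tau_tilde_sq_le[OF assms(3-5), of u xt] sum_sample_prob[OF yhat assms(4,5)]
    by (intro add_mono mult_left_mono[of _ _ "1 / real t"] mult_right_mono)
      (auto simp: P_def yhat_def \<tau>_def)
  finally show ?thesis unfolding yhat_def A_def by simp
qed

section \<open>Induction over the rounds\<close>

text \<open>Causality: writing a freshly sampled label into the history leaves all iterates up to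
  the current round unchanged.\<close>

lemma dford_iterate_cong:
  assumes "\<And>s. s < t \<Longrightarrow> ytil s = ytil' s"
  shows "dford_iterate K lam \<gamma> x y ytil t = dford_iterate K lam \<gamma> x y ytil' t"
  using assms
  by (induction K lam \<gamma> x y ytil t rule: dford_iterate.induct) auto

text \<open>The tower rule, conditioning on the first \<open>t\<close> labels.\<close>

lemma expectation_dford_pmf_Suc:
  fixes x :: "nat \<Rightarrow> real ^ 'd::finite" and h :: "(nat \<Rightarrow> nat) \<Rightarrow> real"
  assumes "K \<ge> 1" "0 < \<gamma>" "\<gamma> \<le> 1"
  shows "measure_pmf.expectation (dford_pmf K lam \<gamma> x y (Suc t)) h =
    measure_pmf.expectation (dford_pmf K lam \<gamma> x y t) (\<lambda>ytil.
      measure_pmf.expectation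
        (sample_pmf K \<gamma> (predicted_label K (dford_iterate K lam \<gamma> x y ytil (Suc t)) (x (Suc t))))
        (\<lambda>k. h (ytil(Suc t := k))))"
  unfolding dford_pmf.simps
  using finite_set_dford_pmf[OF assms]
  by (subst expectation_bind_pmf_finite)
    (auto intro!: finite_imageI finite_set_sample_pmf predicted_label_in assms[simplified]
      simp del: dford_iterate.simps)

lemma dford_iterate_upd:
  "dford_iterate K lam \<gamma> x y (ytil(Suc n := k)) (Suc (Suc n)) =
     dford_step K lam \<gamma> (Suc n) (x (Suc n)) (y (Suc n)) k (dford_iterate K lam \<gamma> x y ytil (Suc n))"
  using dford_iterate_cong[of "Suc n" "ytil(Suc n := k)" ytil K lam \<gamma> x y] by simp

lemma expectation_iterate_sq_norm_le:
  fixes x :: "nat \<Rightarrow> real ^ 'd::finite"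
  assumes "lam > 0" "0 < \<gamma>" "\<gamma> \<le> 1" "K \<ge> 1"
    and "\<And>t. t \<in> {1..n} \<Longrightarrow> y t \<in> {1..K}" "\<And>t. t \<in> {1..n} \<Longrightarrow> norm (x t) \<le> R"
  shows "measure_pmf.expectation (dford_pmf K lam \<gamma> x y n)
      (\<lambda>ytil. lam\<^sup>2 * sq_norm K (dford_iterate K lam \<gamma> x y ytil (Suc n)))
    \<le> 3 * (real K)\<^sup>2 * ln (real K) / \<gamma> * (R\<^sup>2 + 1)"
  using assms(5,6)
proof (induction n)
  case 0
  show ?case using assms by (simp add: sq_norm_def)
next
  case (Suc n)
  define B where "B = 3 * (real K)\<^sup>2 * ln (real K) / \<gamma> * (R\<^sup>2 + 1)"
  define p where "p = dford_pmf K lam \<gamma> x y n"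
  define u where "u ytil = dford_iterate K lam \<gamma> x y ytil (Suc n)" for ytil
  have int: "integrable p f" for f :: "_ \<Rightarrow> real"
    unfolding p_def using assms by (intro integrable_measure_pmf_finite finite_set_dford_pmf)
  have "measure_pmf.expectation (dford_pmf K lam \<gamma> x y (Suc n))
      (\<lambda>ytil. lam\<^sup>2 * sq_norm K (dford_iterate K lam \<gamma> x y ytil (Suc (Suc n))))
    = measure_pmf.expectation p (\<lambda>ytil.
        measure_pmf.expectation (sample_pmf K \<gamma> (predicted_label K (u ytil) (x (Suc n))))
          (\<lambda>k. lam\<^sup>2 * sq_norm K
            (dford_step K lam \<gamma> (Suc n) (x (Suc n)) (y (Suc n)) k (u ytil))))"
    unfolding p_def u_def
    by (subst expectation_dford_pmf_Suc[OF assms(4,2,3)]) (simp only: dford_iterate_upd)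
  also have "\<dots> \<le> measure_pmf.expectation p (\<lambda>ytil.
      (1 - 1 / real (Suc n)) * (lam\<^sup>2 * sq_norm K (u ytil)) + 1 / real (Suc n) * B)"
    unfolding B_def using assms Suc.prems
    by (intro integral_mono int expectation_dford_step_norm) auto
  also have "\<dots> = (1 - 1 / real (Suc n)) *
      measure_pmf.expectation p (\<lambda>ytil. lam\<^sup>2 * sq_norm K (u ytil)) + 1 / real (Suc n) * B"
    by (subst Bochner_Integration.integral_add[OF int int]) simp
  \<comment> \<open>The recursion averages two quantities bounded by \<open>B\<close>, so the bound
    is preserved without growth in \<open>n\<close>.\<close>
  also have "\<dots> \<le> (1 - 1 / real (Suc n)) * B + 1 / real (Suc n) * B"
  proof (intro add_right_mono mult_left_mono)
    show "measure_pmf.expectation p (\<lambda>ytil. lam\<^sup>2 * sq_norm K (u ytil)) \<le> B"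
      using Suc.IH Suc.prems unfolding p_def u_def B_def by auto
  qed simp
  also have "\<dots> = B" by (simp add: algebra_simps)
  finally show ?case unfolding B_def .
qed

text \<open>The potential is the cumulative regret plus the weighted distance to the comparator.
  Round \<open>t\<close> raises its expectation by at most \<open>2 * B / (lam * t)\<close>, hence
  the harmonic number.\<close>

lemma expectation_regret_le:
  fixes x :: "nat \<Rightarrow> real ^ 'd::finite" and c :: "'d param"
  assumes "lam > 0" "0 < \<gamma>" "\<gamma> \<le> 1" "K \<ge> 1"
    and "\<And>t. t \<in> {1..n} \<Longrightarrow> y t \<in> {1..K}" "\<And>t. t \<in> {1..n} \<Longrightarrow> norm (x t) \<le> R"
  shows "measure_pmf.expectation (dford_pmf K lam \<gamma> x y n) (\<lambda>ytil.
      (\<Sum>t\<in>{1..n}. reg_loss K lam (dford_iterate K lam \<gamma> x y ytil t) (x t) (y t)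
                   - reg_loss K lam c (x t) (y t))
      + lam * real n / 2 * sq_dist K (dford_iterate K lam \<gamma> x y ytil (Suc n)) c)
    \<le> 2 * (3 * (real K)\<^sup>2 * ln (real K) / \<gamma> * (R\<^sup>2 + 1)) / lam * harm n"
  using assms(5,6)
proof (induction n)
  case 0
  \<comment> \<open>The distance has weight 0 at the start, so the norm of the comparator leaves no
    trace in the bound.\<close>
  show ?case by (simp add: harm_def)
next
  case (Suc n)
  define B where "B = 3 * (real K)\<^sup>2 * ln (real K) / \<gamma> * (R\<^sup>2 + 1)"
  define p where "p = dford_pmf K lam \<gamma> x y n"
  define u where "u ytil = dford_iterate K lam \<gamma> x y ytil (Suc n)" for ytil
  define S where "S n ytil = (\<Sum>t\<in>{1..n}. reg_loss K lam (dford_iterate K lam \<gamma> x y ytil t) (x t) (y t)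
                   - reg_loss K lam c (x t) (y t))" for n ytil
  define q where "q ytil = sample_pmf K \<gamma> (predicted_label K (u ytil) (x (Suc n)))" for ytil
  have int: "integrable p f" for f :: "_ \<Rightarrow> real"
    unfolding p_def using assms by (intro integrable_measure_pmf_finite finite_set_dford_pmf)
  have int_q: "integrable (q ytil) f" for ytil and f :: "_ \<Rightarrow> real"
    unfolding q_def using assms
    by (intro integrable_measure_pmf_finite finite_set_sample_pmf predicted_label_in)
  \<comment> \<open>The label of round \<open>n + 1\<close> influences no iterate in this sum, so
    the regret terms are constants for the inner expectation.\<close>
  have S_upd: "S (Suc n) (ytil(Suc n := k)) = S n ytil +
      (reg_loss K lam (u ytil) (x (Suc n)) (y (Suc n)) - reg_loss K lam c (x (Suc n)) (y (Suc n)))"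
    for ytil k
  proof -
    have "dford_iterate K lam \<gamma> x y (ytil(Suc n := k)) t = dford_iterate K lam \<gamma> x y ytil t"
      if "t \<in> {1..Suc n}" for t
      using that by (intro dford_iterate_cong) auto
    then show ?thesis by (simp add: S_def u_def)
  qed
  have "measure_pmf.expectation (dford_pmf K lam \<gamma> x y (Suc n)) (\<lambda>ytil. S (Suc n) ytil
      + lam * real (Suc n) / 2 * sq_dist K (dford_iterate K lam \<gamma> x y ytil (Suc (Suc n))) c)
    = measure_pmf.expectation p (\<lambda>ytil. measure_pmf.expectation (q ytil)
          (\<lambda>k. (S n ytil + (reg_loss K lam (u ytil) (x (Suc n)) (y (Suc n))
                  - reg_loss K lam c (x (Suc n)) (y (Suc n))))
            + lam * real (Suc n) / 2 * sq_dist K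
            (dford_step K lam \<gamma> (Suc n) (x (Suc n)) (y (Suc n)) k (u ytil)) c))"
    unfolding p_def q_def u_def
    by (subst expectation_dford_pmf_Suc[OF assms(4,2,3)]) (simp only: dford_iterate_upd S_upd u_def)
  also have "\<dots> = measure_pmf.expectation p (\<lambda>ytil.
      (S n ytil + (reg_loss K lam (u ytil) (x (Suc n)) (y (Suc n))
                  - reg_loss K lam c (x (Suc n)) (y (Suc n))))
      + measure_pmf.expectation (q ytil) (\<lambda>k. lam * real (Suc n) / 2 * sq_dist K
            (dford_step K lam \<gamma> (Suc n) (x (Suc n)) (y (Suc n)) k (u ytil)) c))"
    by (subst Bochner_Integration.integral_add[OF int_q int_q]) simp
  also have "\<dots> \<le> measure_pmf.expectation p (\<lambda>ytil.
      (S n ytil + (reg_loss K lam (u ytil) (x (Suc n)) (y (Suc n))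
                  - reg_loss K lam c (x (Suc n)) (y (Suc n))))
      + (lam * (real (Suc n) - 1) / 2 * sq_dist K (u ytil) c
         - (reg_loss K lam (u ytil) (x (Suc n)) (y (Suc n))
                  - reg_loss K lam c (x (Suc n)) (y (Suc n)))
         + (lam\<^sup>2 * sq_norm K (u ytil) + B) / (lam * real (Suc n))))"
    unfolding B_def q_def using assms Suc.prems
    by (intro integral_mono int add_left_mono expectation_dford_step_dist) auto
  \<comment> \<open>The regret of round \<open>n + 1\<close> cancels, and the remaining distance has
    the weight \<open>lam * n / 2\<close> required by the induction hypothesis.\<close>
  also have "\<dots> = measure_pmf.expectation p (\<lambda>ytil.
      (S n ytil + lam * real n / 2 * sq_dist K (u ytil) c)
      + (lam\<^sup>2 * sq_norm K (u ytil) / (lam * real (Suc n)) + B / (lam * real (Suc n))))"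
    by (intro Bochner_Integration.integral_cong) (simp_all add: add_divide_distrib)
  also have "\<dots> = measure_pmf.expectation p (\<lambda>ytil.
      S n ytil + lam * real n / 2 * sq_dist K (u ytil) c)
      + (measure_pmf.expectation p (\<lambda>ytil. lam\<^sup>2 * sq_norm K (u ytil)) / (lam * real (Suc n))
         + B / (lam * real (Suc n)))"
    by (subst Bochner_Integration.integral_add[OF int int],
        subst Bochner_Integration.integral_add[OF int int]) simp
  \<comment> \<open>One \<open>B\<close> bounds the regularization part of the gradient, through the
    iterate norm, and the other its hinge part.\<close>
  also have "\<dots> \<le> 2 * B / lam * harm n + (B / (lam * real (Suc n)) + B / (lam * real (Suc n)))"
  proof (intro add_mono divide_right_mono)
    show "measure_pmf.expectation p (\<lambda>ytil. S n ytil + lam * real n / 2 * sq_dist K (u ytil) c)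
        \<le> 2 * B / lam * harm n"
      using Suc.IH Suc.prems unfolding p_def u_def B_def S_def by auto
    show "measure_pmf.expectation p (\<lambda>ytil. lam\<^sup>2 * sq_norm K (u ytil)) \<le> B"
      unfolding p_def u_def B_def using assms Suc.prems
      by (intro expectation_iterate_sq_norm_le) auto
  qed (use assms in auto)
  also have "\<dots> = 2 * B / lam * harm (Suc n)"
    by (simp add: harm_Suc distrib_left inverse_eq_divide mult.commute)
  finally show ?case unfolding B_def S_def .
qed

section \<open>From the harmonic sum to the logarithm of the horizon\<close>

theorem theorem2:
  fixes K T :: nat and lam \<gamma> R :: real
    and X :: "(real ^ 'd) set"
    and x :: "nat \<Rightarrow> real ^ 'd::finite" and y :: "nat \<Rightarrow> nat"
    and w :: "real ^ 'd" and \<theta> :: "nat \<Rightarrow> real"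
  assumes "K \<ge> 1" and "T \<ge> 1"
    and "lam > 0" and "0 < \<gamma>" and "\<gamma> \<le> 1"
    and "\<And>t. t \<in> {1..T} \<Longrightarrow> x t \<in> X"
    and "\<And>t. t \<in> {1..T} \<Longrightarrow> y t \<in> {1..K}"
    and "\<And>t. t \<in> {1..T} \<Longrightarrow> norm (x t) \<le> R"
  shows "measure_pmf.expectation (dford_pmf K lam \<gamma> x y T)
           (\<lambda>ytil. (\<Sum>t\<in>{1..T}. reg_loss K lam (dford_iterate K lam \<gamma> x y ytil t) (x t) (y t))
                 - (\<Sum>t\<in>{1..T}. reg_loss K lam (w, \<theta>) (x t) (y t)))
         \<le> 16 * (real K)\<^sup>2 * (R\<^sup>2 + 1) * ln (real K) * ln (real T) / (lam * \<gamma>)"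
    (is "measure_pmf.expectation ?p ?h \<le> _")
proof -
  have int: "integrable ?p f" for f :: "_ \<Rightarrow> real"
    using assms by (intro integrable_measure_pmf_finite finite_set_dford_pmf)
  show ?thesis
  proof (cases "T = 1")
    case True
    \<comment> \<open>The bound is \<open>0\<close> here, below the general estimate, but the first iterate has loss \<open>0\<close>.\<close>
    have y1: "y 1 \<in> {1..K}" using assms by auto
    have "reg_loss K lam (0, \<lambda>_. 0) (x 1) (y 1) = 0"
      unfolding reg_loss_eq[OF y1] by (simp add: sq_norm_def real_margin_def)
    moreover have "0 \<le> reg_loss K lam (w, \<theta>) (x 1) (y 1)"
      unfolding reg_loss_eq[OF y1] using assms sq_norm_nonneg[of K "(w, \<theta>)"]
      by (intro add_nonneg_nonneg sum_nonneg) auto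
    ultimately have "?h ytil \<le> 0" for ytil
      using True by simp
    then have "measure_pmf.expectation ?p ?h \<le> measure_pmf.expectation ?p (\<lambda>_. 0)"
      by (intro integral_mono int)
    then show ?thesis using True by simp
  next
    case False
    then have T: "T \<ge> 2" using assms by simp
    define B where "B = (real K)\<^sup>2 * ln (real K) / \<gamma> * (R\<^sup>2 + 1) / lam"
    have B: "0 \<le> B" unfolding B_def using assms by auto
    \<comment> \<open>Adding the nonnegative final distance produces the potential of
      \<open>expectation_regret_le\<close>.\<close>
    have "measure_pmf.expectation ?p ?h \<le> measure_pmf.expectation ?p (\<lambda>ytil.
        (\<Sum>t\<in>{1..T}. reg_loss K lam (dford_iterate K lam \<gamma> x y ytil t) (x t) (y t)
                     - reg_loss K lam (w, \<theta>) (x t) (y t))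
        + lam * real T / 2 * sq_dist K (dford_iterate K lam \<gamma> x y ytil (Suc T)) (w, \<theta>))"
      using assms by (intro integral_mono int) (simp add: sum_subtractf sq_dist_nonneg)
    also have "\<dots> \<le> 2 * (3 * (real K)\<^sup>2 * ln (real K) / \<gamma> * (R\<^sup>2 + 1)) / lam * harm T"
      using assms by (intro expectation_regret_le) auto
    also have "\<dots> = B * (6 * harm T)" by (simp add: B_def)
    also have "\<dots> \<le> B * (16 * ln (real T))"
    proof (intro mult_left_mono B)
      \<comment> \<open>It suffices that \<open>6 * (1 + ln T) \<le> 16 * ln T\<close>, that is
        \<open>ln T \<ge> 3/5\<close>, which follows from \<open>ln 2 \<ge> 2/3\<close>.\<close>
      have "ln 2 \<le> ln (real T)" using T by simp
      then show "6 * harm T \<le> 16 * ln (real T)"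
        using harm_le_ln[of T] T ln2_ge_two_thirds by linarith
    qed
    also have "\<dots> = 16 * (real K)\<^sup>2 * (R\<^sup>2 + 1) * ln (real K) * ln (real T) / (lam * \<gamma>)"
      by (simp add: B_def mult_ac)
    finally show ?thesis .
  qed
qed

end
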